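(* Saaty's consistency index $C.I.$ does not satisfy the upper boundary axiom, i.e. it is not bounded from above on $M_R$: there is no $K\in\mathbb{R}$ such that $C.I.(A)\le K$ for all $A\in M_R$.
   Context: Let $n$ be the number of compared alternatives. $M_R$ is the set of all reciprocal pairwise comparison matrices of order $n$ with positive elements, that is, all real $n\times n$ matrices $A=(a_{ij})$ with $a_{ij}>0$ and $a_{ij}=1/a_{ji}$ for all $i,j\in\{1,2,\dots,n\}$. For $A\in M_R$, $\lambda_{\max}$ denotes the largest (positive) eigenvalue of $A$, whose existence is guaranteed by the Perron-Frobenius theorem, and Saaty's consistency index is $C.I.(A)=\frac{\lambda_{\max}-n}{n-1}$. The upper boundary axiom for an inconsistency index $ICI$ (a real-valued function on $M_R$) requires that $ICI$ be bounded from above: there exists $K\in\mathbb{R}$ such that $ICI(A)\le K$ for all $A\in M_R$.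
   Formalization: The claim is proved for each fixed order n ≥ 3; this bound is added because for n = 2 every reciprocal matrix has eigenvalues 0 and 2, so C.I. is identically 0 and bounded, and for n = 1 the index is 0/0. *)

theory Defs
  imports "Jordan_Normal_Form.Spectral_Radius"
begin

definition reciprocal_matrices :: "nat \<Rightarrow> real mat set" where
  "reciprocal_matrices n =
     {A \<in> carrier_mat n n. \<forall>i<n. \<forall>j<n. A $$ (i, j) > 0 \<and> A $$ (i, j) = 1 / A $$ (j, i)}"

text \<open>Since the entries of \<open>A\<close> are real, \<open>spectrum A\<close> consists of its real eigenvalues.
  It is finite, and by Perron-Frobenius nonempty when \<open>A\<close> has positive entries and order
  at least 1, so the maximum exists.\<close>

definition lambda_max :: "real mat \<Rightarrow> real" where
  "lambda_max A = Max (spectrum A)"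

definition saaty_CI :: "nat \<Rightarrow> real mat \<Rightarrow> real" where
  "saaty_CI n A = (lambda_max A - real n) / (real n - 1)"

definition upper_boundary_axiom :: "nat \<Rightarrow> (real mat \<Rightarrow> real) \<Rightarrow> bool" where
  "upper_boundary_axiom n ICI \<longleftrightarrow> (\<exists>K. \<forall>A \<in> reciprocal_matrices n. ICI A \<le> K)"

end

theory Submission
  imports Defs
begin

text \<open>Let all entries of \<open>A\<close> be 1 except \<open>a\<^sub>1\<^sub>2 = u\<close> and \<open>a\<^sub>2\<^sub>1 = 1/u\<close>. An eigenvector that is
  constant from the third coordinate on reduces \<open>A\<close> to a \<open>3 \<times> 3\<close> matrix, whose
  characteristic equation is \<open>x\<^sup>2 (x - n) = (n - 2) (u - 1)\<^sup>2 / u\<close>. As \<open>(u - 1)\<^sup>2 / u\<close>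
  takes every nonnegative value, every \<open>x \<ge> n\<close> is an eigenvalue of some such \<open>A\<close>.\<close>

definition perturbed_ones :: "nat \<Rightarrow> real \<Rightarrow> real mat" where
  "perturbed_ones n u = mat n n (\<lambda>(i, j).
     if i = 0 \<and> j = 1 then u else if i = 1 \<and> j = 0 then 1 / u else 1)"

lemma perturbed_ones_reciprocal:
  assumes "u > 0"
  shows "perturbed_ones n u \<in> reciprocal_matrices n"
  using assms by (auto simp: perturbed_ones_def reciprocal_matrices_def)

lemma sum_split_first_two:
  fixes f :: "nat \<Rightarrow> 'a::comm_monoid_add"
  assumes "n \<ge> 2"
  shows "(\<Sum>j = 0..<n. f j) = f 0 + (f 1 + (\<Sum>j = 2..<n. f j))"
  using assms by (simp add: sum.atLeast_Suc_lessThan numeral_2_eq_2)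

lemma perturbed_ones_eigenvalue:
  fixes x u :: real
  assumes n: "n \<ge> 3" and u: "u > 0" and x: "x > 0"
    and char_eq: "x\<^sup>2 * (x - real n) = (real n - 2) * (u + 1 / u - 2)"
  shows "eigenvalue (perturbed_ones n u) x"
proof -
  define d where "d = u + 1 / u - 2"
  \<comment> \<open>Fix the common value c of the coordinates from the third on. Each of their rows
    says that all coordinates sum to x * c, so the first two rows become a 2 x 2 linear system with
    determinant \<open>x\<^sup>2 + d\<close>. Taking c to be this determinant, Cramer's rule gives
    the first two entries without fractions.\<close>
  define v where "v = vec n (\<lambda>i. if i = 0 then x * (x + u - 1)
    else if i = 1 then x * (x + 1 / u - 1) else x\<^sup>2 + d)"
  have "d = (u - 1)\<^sup>2 / u"
    using u by (simp add: d_def field_simps power2_eq_square)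
  then have "d \<ge> 0"
    using u by simp
  then have pos: "x\<^sup>2 + d > 0"
    using x by (simp add: add_pos_nonneg)
  \<comment> \<open>The one equation left, that the coordinates sum to x * c; it is the
    characteristic equation rearranged.\<close>
  have tail_sum: "(real n - 2) * (x\<^sup>2 + d) = x\<^sup>2 * (x - 2)"
    using char_eq by (simp add: d_def algebra_simps)
  have tail: "real (n - 2) = real n - 2"
    using n by simp
  have "v \<noteq> 0\<^sub>v n"
  proof
    assume "v = 0\<^sub>v n"
    then have "v $ 2 = 0"
      using n by simp
    then show False
      using n pos by (simp add: v_def)
  qed
  moreover have "perturbed_ones n u *\<^sub>v v = x \<cdot>\<^sub>v v"
  proof (rule eq_vecI)
    fix i assume "i < dim_vec (x \<cdot>\<^sub>v v)"
    then have i: "i < n"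
      by (simp add: v_def)
    have row: "(perturbed_ones n u *\<^sub>v v) $ i =
        (if i = 1 then 1 / u else 1) * (x * (x + u - 1))
        + ((if i = 0 then u else 1) * (x * (x + 1 / u - 1)) + x\<^sup>2 * (x - 2))"
      using n i
      by (simp add: perturbed_ones_def v_def scalar_prod_def sum_split_first_two tail tail_sum)
    consider "i = 0" | "i = 1" | "i \<ge> 2"
      by linarith
    then show "(perturbed_ones n u *\<^sub>v v) $ i = (x \<cdot>\<^sub>v v) $ i"
    proof cases
      case 1
      have "u * (x * (x + 1 / u - 1)) = x * (u * x + 1 - u)"
        using u by (simp add: algebra_simps)
      then show ?thesis
        using row n 1 by (simp add: v_def algebra_simps power2_eq_square)
    next
      case 2
      have "1 / u * (x * (x + u - 1)) = x * (x * (1 / u) + 1 - 1 / u)"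
        using u by (simp add: field_simps)
      then show ?thesis
        using row n 2 by (simp add: v_def algebra_simps power2_eq_square)
    next
      case 3
      then show ?thesis
        using row i n by (simp add: v_def d_def algebra_simps power2_eq_square)
    qed
  qed (simp add: v_def perturbed_ones_def)
  ultimately show ?thesis
    unfolding eigenvalue_def eigenvector_def
    by (intro exI[of _ v]) (simp add: v_def perturbed_ones_def)
qed

lemma ex_pos_add_inverse_eq:
  fixes d :: real
  assumes "d \<ge> 0"
  shows "\<exists>u>0. u + 1 / u - 2 = d"
proof -
  \<comment> \<open>u is the larger root of \<open>u\<^sup>2 - (d + 2) * u + 1 = 0\<close>, and
    \<open>r\<^sup>2\<close> is a quarter of its discriminant.\<close>
  define r where "r = sqrt (d + d\<^sup>2 / 4)"
  define u where "u = 1 + d / 2 + r"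
  have r: "r \<ge> 0" "r * r = d + d\<^sup>2 / 4"
    using assms by (simp_all add: r_def)
  have u: "u > 0"
    using assms r by (simp add: u_def)
  have "u * u + 1 = (d + 2) * u"
    using r(2) by (simp add: u_def algebra_simps power2_eq_square)
  then have "u + 1 / u - 2 = d"
    using u by (simp add: field_simps)
  with u show ?thesis
    by blast
qed

text \<open>The spectrum is finite, so \<open>Max\<close> bounds each of its members. Exhibiting any
  large eigenvalue therefore suffices; it need not be identified as the largest.\<close>

lemma le_lambda_max:
  assumes "A \<in> carrier_mat n n" "eigenvalue A x"
  shows "x \<le> lambda_max A"
  using assms card_finite_spectrum(1)[OF assms(1)]
  by (simp add: lambda_max_def spectrum_def)

theorem proposition18:
  fixes n :: nat
  assumes "n \<ge> 3"
  shows "\<not> upper_boundary_axiom n (saaty_CI n)"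
proof
  assume "upper_boundary_axiom n (saaty_CI n)"
  then obtain K where K: "saaty_CI n A \<le> K" if "A \<in> reciprocal_matrices n" for A
    unfolding upper_boundary_axiom_def by blast
  \<comment> \<open>Chosen so that (x - n) / (n - 1) = |K| + 1, which exceeds K; the absolute value
    ensures x \<ge> n, so that a suitable u exists.\<close>
  define x where "x = real n + (real n - 1) * (\<bar>K\<bar> + 1)"
  have n1: "real n - 1 > 0" and n2: "real n - 2 > 0"
    using assms by simp_all
  have x: "x \<ge> real n" "x > 0"
    using assms n1 by (simp_all add: x_def add_pos_nonneg)
  have "x\<^sup>2 * (x - real n) / (real n - 2) \<ge> 0"
    using x n2 by simp
  then obtain u where u: "u > 0" "u + 1 / u - 2 = x\<^sup>2 * (x - real n) / (real n - 2)"
    using ex_pos_add_inverse_eq by blast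
  define A where "A = perturbed_ones n u"
  have A: "A \<in> reciprocal_matrices n"
    using u(1) by (simp add: A_def perturbed_ones_reciprocal)
  have "eigenvalue A x"
    unfolding A_def using assms u x(2) n2 by (intro perturbed_ones_eigenvalue) simp_all
  then have "x \<le> lambda_max A"
    using A by (intro le_lambda_max[where n = n]) (simp_all add: reciprocal_matrices_def)
  then have "(real n - 1) * (\<bar>K\<bar> + 1) \<le> lambda_max A - real n"
    by (simp add: x_def)
  then have "\<bar>K\<bar> + 1 \<le> saaty_CI n A"
    using n1 by (simp add: saaty_CI_def pos_le_divide_eq mult.commute)
  with K[OF A] show False
    by linarith
qed

end
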